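(* Let $X$ be a finite looped multigraph, let $r\ge 1$, let $\alpha$ be an arc function on $X$ with values in $\mathrm{Sym}(r)$, and let $X^\alpha$ be the corresponding $r$-fold cover of $X$. For any edge $e$ of $X$ that is not a loop, \[ \xi(X^{\alpha},t) = (t-1)\,\xi(X^{\alpha}/e,t) + \xi(X^{\alpha}\setminus e, t). \]
   Context: A looped multigraph $X$ consists of a finite vertex set $V_X$, a finite edge set $E_X$, and a function $\rho_X$ assigning to each edge either a single vertex (the edge is then a loop) or an unordered pair of distinct vertices (its endpoints). Distinct edges $e,f$ with $\rho_X(e)=\rho_X(f)$ are called parallel. The arcs of $X$ are its loops (each loop is a single arc) together with, for each non-loop edge, its two opposite orientations. An arc function of index $r$ is a map $\alpha$ from the arcs of $X$ to $\mathrm{Sym}(r)$ such that $\alpha(e)\alpha(e')=1$ whenever $e,e'$ are the two orientations of the same non-loop edge; its value on a loop is arbitrary. Permutations act on the right, $i\mapsto i^{\pi}$, so $i^{\pi\sigma}=(i^\pi)^\sigma$. The cover $X^\alpha$ (an $r$-fold cover of $X$) is the looped multigraph with vertex set $V_X\times\{1,\dots,r\}$. For each non-loop edge $e$ with endpoints $u,v$ it has $r$ edges $e_1,\dots,e_r$, where, orienting $e$ from $u$ to $v$, $e_i$ has endpoints $(u,i)$ and $(v,i^{\alpha(e)})$ (choosing the opposite orientation gives the same set of edges up to labelling). For each loop $f$ on $u$ it has $r$ edges $f_1,\dots,f_r$, where $f_i$ has endpoints $(u,i)$ and $(u,i^{\alpha(f)})$ (so $f_i$ is a loop if $i$ is fixed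 by $\alpha(f)$). The fibre at $u$ is $\{(u,i):1\le i\le r\}$. A transversal is a set of $|V_X|$ vertices of the cover, one from each fibre. A transversal subgraph is the subgraph induced by a transversal, including all loops and parallel edges with all endpoints in the transversal. The transversal polynomial is $\xi(X^\alpha,t)=\sum_H t^{|E_H|}$, the sum running over all transversal subgraphs $H$ of $X^\alpha$ (one per transversal). Deletion: $X^\alpha\setminus e$ is obtained from $X^\alpha$ by deleting the edges $e_1,\dots,e_r$; it is an $r$-fold cover of $X\setminus e$, with the same fibres as $X^\alpha$. Contraction: for a non-loop edge $e$ oriented from $u$ to $v$, $X^\alpha/e$ is obtained from $X^\alpha$ by simultaneously contracting all edges of the matching $e_1,\dots,e_r$. That is, its vertex set is $(V_X\setminus\{v\})\times\{1,\dots,r\}$, its edges are those of $X^\alpha$ other than $e_1,\dots,e_r$, and each endpoint $(v,j)$ of an edge is replaced by $(u,j^{\alpha(e)^{-1}})$, all other endpoints being unchanged; an edge whose two endpoints become equal becomes a loop. It is an $r$-fold cover of $X/e$ (obtained from $X$ by deleting $e$ and $v$ and replacing endpoint $v$ by $u$ in all other edges), with fibres $\{(w,i):1\le i\le r\}$ for $w\in V_X\setminus\{v\}$, and $\xi(X^\alpha/e,t)$ is defined with respect to these fibres. *)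

theory Defs
  imports Main "HOL-Combinatorics.Permutations" "HOL-Computational_Algebra.Polynomial"
begin

record ('v, 'e) lmgraph =
  verts :: "'v set"
  edges :: "'e set"
  ends  :: "'e \<Rightarrow> 'v set"

definition looped_multigraph :: "('v, 'e) lmgraph \<Rightarrow> bool" where
  "looped_multigraph X \<longleftrightarrow>
     finite (verts X) \<and> finite (edges X) \<and>
     (\<forall>e\<in>edges X. ends X e \<subseteq> verts X \<and> (card (ends X e) = 1 \<or> card (ends X e) = 2))"

definition is_loop :: "('v, 'e) lmgraph \<Rightarrow> 'e \<Rightarrow> bool" where
  "is_loop X e \<longleftrightarrow> card (ends X e) = 1"

text \<open>The arc \<open>(e, u, v)\<close> is the edge \<open>e\<close> oriented from \<open>u\<close> to \<open>v\<close>.  A loop \<open>f\<close> on \<open>u\<close> gives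
  the single arc \<open>(f, u, u)\<close>; a non-loop edge gives exactly two arcs.\<close>

type_synonym ('v, 'e) arc = "'e \<times> 'v \<times> 'v"

definition arcs :: "('v, 'e) lmgraph \<Rightarrow> ('v, 'e) arc set" where
  "arcs X = {(e, u, v). e \<in> edges X \<and> ends X e = {u, v}}"

text \<open>\<open>Sym(r)\<close> is the set of functions permuting \<open>{1..r}\<close> (and fixing every other natural
  number).  Permutations act on the right, \<open>i\<^sup>\<pi> = \<pi> i\<close>, so the product \<open>\<pi>\<sigma>\<close> is \<open>\<sigma> \<circ> \<pi>\<close>.\<close>

definition arc_function ::
  "('v, 'e) lmgraph \<Rightarrow> nat \<Rightarrow> (('v, 'e) arc \<Rightarrow> nat \<Rightarrow> nat) \<Rightarrow> bool" where
  "arc_function X r \<alpha> \<longleftrightarrow>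
     (\<forall>a\<in>arcs X. \<alpha> a permutes {1..r}) \<and>
     (\<forall>e u v. (e, u, v) \<in> arcs X \<and> \<not> is_loop X e \<longrightarrow> \<alpha> (e, v, u) \<circ> \<alpha> (e, u, v) = id)"

text \<open>A choice, for every edge, of the arc used to label its lifts in the cover.  Different
  choices give covers that differ only in the labels of the edges.\<close>

definition orientation :: "('v, 'e) lmgraph \<Rightarrow> ('e \<Rightarrow> 'v \<times> 'v) \<Rightarrow> bool" where
  "orientation X ori \<longleftrightarrow> (\<forall>e\<in>edges X. (e, ori e) \<in> arcs X)"

text \<open>The pair \<open>(e, i)\<close> is the lift \<open>e\<^sub>i\<close>.  For a loop \<open>f\<close> on \<open>u\<close> we have \<open>ori f = (u, u)\<close>, so the
  same formula gives \<open>f\<^sub>i\<close> the endpoints \<open>(u, i)\<close> and \<open>(u, \<alpha> (f, u, u) i)\<close>.\<close>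

definition cover ::
  "('v, 'e) lmgraph \<Rightarrow> nat \<Rightarrow> (('v, 'e) arc \<Rightarrow> nat \<Rightarrow> nat) \<Rightarrow> ('e \<Rightarrow> 'v \<times> 'v) \<Rightarrow>
   ('v \<times> nat, 'e \<times> nat) lmgraph" where
  "cover X r \<alpha> ori =
     \<lparr> verts = verts X \<times> {1..r},
       edges = edges X \<times> {1..r},
       ends = (\<lambda>(e, i). case ori e of (u, v) \<Rightarrow> {(u, i), (v, \<alpha> (e, u, v) i)}) \<rparr>"

definition fibre :: "nat \<Rightarrow> 'v \<Rightarrow> ('v \<times> nat) set" where
  "fibre r u = {u} \<times> {1..r}"

definition lifts :: "nat \<Rightarrow> 'e \<Rightarrow> ('e \<times> nat) set" where
  "lifts r e = {e} \<times> {1..r}"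

text \<open>In the next definitions \<open>Y\<close> is a graph whose vertices are partitioned into the fibres
  \<open>fibre r w\<close> for \<open>w\<close> in \<open>V\<close>.\<close>

definition transversals ::
  "('v \<times> nat, 'f) lmgraph \<Rightarrow> 'v set \<Rightarrow> nat \<Rightarrow> ('v \<times> nat) set set" where
  "transversals Y V r =
     {T. T \<subseteq> verts Y \<and> card T = card V \<and> (\<forall>w\<in>V. card (T \<inter> fibre r w) = 1)}"

definition induced_subgraph :: "('v, 'e) lmgraph \<Rightarrow> 'v set \<Rightarrow> ('v, 'e) lmgraph" where
  "induced_subgraph Y T = Y\<lparr> verts := T, edges := {f \<in> edges Y. ends Y f \<subseteq> T} \<rparr>"

definition transversal_poly :: "('v \<times> nat, 'f) lmgraph \<Rightarrow> 'v set \<Rightarrow> nat \<Rightarrow> int poly" where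
  "transversal_poly Y V r =
     (\<Sum>T\<in>transversals Y V r. monom 1 (card (edges (induced_subgraph Y T))))"

definition delete_lifts ::
  "('v \<times> nat, 'e \<times> nat) lmgraph \<Rightarrow> nat \<Rightarrow> 'e \<Rightarrow> ('v \<times> nat, 'e \<times> nat) lmgraph" where
  "delete_lifts Y r e = Y\<lparr> edges := edges Y - lifts r e \<rparr>"

text \<open>Here \<open>Y\<close> is a cover determined by the arc function \<open>\<alpha>\<close>; the lifts of the arc \<open>(e, u, v)\<close>
  join \<open>(u, i)\<close> to \<open>(v, \<alpha> (e, u, v) i)\<close>, and the second of these is merged into the first.\<close>

definition contract_lifts ::
  "('v \<times> nat, 'e \<times> nat) lmgraph \<Rightarrow> nat \<Rightarrow> (('v, 'e) arc \<Rightarrow> nat \<Rightarrow> nat) \<Rightarrow> ('v, 'e) arc \<Rightarrow>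
   ('v \<times> nat, 'e \<times> nat) lmgraph" where
  "contract_lifts Y r \<alpha> = (\<lambda>(e, u, v).
     \<lparr> verts = verts Y - fibre r v,
       edges = edges Y - lifts r e,
       ends = (\<lambda>f. (\<lambda>(w, j). if w = v then (u, inv (\<alpha> (e, u, v)) j) else (w, j)) ` ends Y f) \<rparr>)"

end

theory Submission
  imports Defs
begin

text \<open>Deleting the lifts of \<open>e\<close> changes the exponent of a transversal \<open>T\<close> only if \<open>T\<close> contains a
  lift of \<open>e\<close>, and then it contains exactly one.  Such a \<open>T\<close> is determined by its part outside the
  fibre of \<open>v\<close>, which is an arbitrary transversal of the contraction inducing there the same edges
  as \<open>T\<close> does in the deletion.\<close>

text \<open>A subset of \<open>V \<times> {1..r}\<close> that meets every fibre exactly once is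
  mapped bijectively onto \<open>V\<close> by \<open>fst\<close>, which yields
  \<open>card T = card V\<close>. Unique indices are the form in which the later arguments use
  transversals.\<close>

lemma transversals_iff:
  assumes V: "verts Y = V \<times> {1..r}" and "finite V"
  shows "T \<in> transversals Y V r \<longleftrightarrow> T \<subseteq> V \<times> {1..r} \<and> (\<forall>w\<in>V. \<exists>!i. (w, i) \<in> T)"
proof (cases "T \<subseteq> V \<times> {1..r}")
  case True
  have fib: "card (T \<inter> fibre r w) = 1 \<longleftrightarrow> (\<exists>!i. (w, i) \<in> T)" for w
  proof -
    have "T \<inter> fibre r w = Pair w ` {i. (w, i) \<in> T}"
      using True by (auto simp: fibre_def)
    then have "card (T \<inter> fibre r w) = card {i. (w, i) \<in> T}"
      by (simp add: card_image inj_on_def)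
    then show ?thesis
      by (auto simp: card_1_singleton_iff Ex1_def)
  qed
  have "card T = card V" if "\<forall>w\<in>V. \<exists>!i. (w, i) \<in> T"
  proof -
    have "inj_on fst T"
      using True that by (fastforce simp: inj_on_def)
    moreover have "fst ` T = V"
      using True that by force
    ultimately show ?thesis
      using card_image by fastforce
  qed
  then show ?thesis
    using True V fib by (auto simp: transversals_def)
qed (auto simp: transversals_def V)

text \<open>A transversal of \<open>Z\<close> has a unique vertex \<open>(u, i)\<close> over
  \<open>u\<close>, and the only vertex over \<open>v\<close> completing it to a member of the
  left-hand set is \<open>(v, p i)\<close>. Edges do not enter here, only the vertex sets.\<close>

lemma transversal_extend_bij:
  assumes fin: "finite V" and uv: "u \<in> V" "v \<in> V" "u \<noteq> v"
    and Y: "verts Y = V \<times> {1..r}" and Z: "verts Z = (V - {v}) \<times> {1..r}"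
    and p: "p permutes {1..r}"
  shows "bij_betw (\<lambda>T. T - fibre r v)
           {T \<in> transversals Y V r. \<exists>i. (u, i) \<in> T \<and> (v, p i) \<in> T}
           (transversals Z (V - {v}) r)"
    (is "bij_betw _ ?M ?N")
proof -
  note trY = transversals_iff[OF Y fin]
  have trZ: "T \<in> ?N \<longleftrightarrow> T \<subseteq> (V - {v}) \<times> {1..r} \<and> (\<forall>w\<in>V - {v}. \<exists>!i. (w, i) \<in> T)" for T
    using transversals_iff[OF Z] fin by simp
  \<comment> \<open>The inverse map. The comprehension avoids choosing \<open>i\<close>: when
    \<open>T\<close> has just one vertex \<open>(u, i)\<close> over \<open>u\<close>, it adds just
    \<open>(v, p i)\<close>.\<close>
  define g where "g T = T \<union> {(v, p i) | i. (u, i) \<in> T}" for T :: "('a \<times> nat) set"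
  have left: "g (T - fibre r v) = T" if T: "T \<in> ?M" for T
  proof -
    have sub: "T \<subseteq> V \<times> {1..r}" and ex1: "\<forall>w\<in>V. \<exists>!i. (w, i) \<in> T"
      using T trY by auto
    obtain i where i: "(u, i) \<in> T" "(v, p i) \<in> T" using T by auto
    have u': "(u, k) \<in> T \<longleftrightarrow> k = i" for k using ex1 uv i by blast
    have v': "(v, k) \<in> T \<longleftrightarrow> k = p i" for k using ex1 uv i by blast
    show ?thesis
      unfolding g_def fibre_def using uv u' v' sub by auto
  qed
  have right: "g S \<in> ?M \<and> g S - fibre r v = S" if S: "S \<in> ?N" for S
  proof -
    have sub: "S \<subseteq> (V - {v}) \<times> {1..r}" and ex1: "\<forall>w\<in>V - {v}. \<exists>!i. (w, i) \<in> S"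
      using S trZ by auto
    obtain i where "(u, i) \<in> S" using ex1 uv by blast
    then have u': "(u, k) \<in> S \<longleftrightarrow> k = i" for k using ex1 uv by blast
    have gS: "g S = insert (v, p i) S" using u' by (auto simp: g_def)
    have pi: "p i \<in> {1..r}"
      using sub u' permutes_in_image[OF p] by blast
    have nv: "(v, k) \<notin> S" for k using sub by blast
    have "\<exists>!k. (w, k) \<in> g S" if "w \<in> V" for w
      using that ex1 nv by (cases "w = v") (auto simp: gS)
    moreover have "g S \<subseteq> V \<times> {1..r}" using sub pi uv gS by auto
    ultimately show ?thesis
      using trY pi u' nv by (auto simp: gS fibre_def)
  qed
  have "T - fibre r v \<in> ?N" if T: "T \<in> ?M" for T
  proof -
    have sub: "T \<subseteq> V \<times> {1..r}" and ex1: "\<forall>w\<in>V. \<exists>!i. (w, i) \<in> T"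
      using T trY by auto
    have "(w, i) \<in> T - fibre r v \<longleftrightarrow> (w, i) \<in> T" if "w \<noteq> v" for w i
      using that by (auto simp: fibre_def)
    then show ?thesis
      using sub ex1 by (auto simp: trZ fibre_def)
  qed
  then show ?thesis
    using left right by (intro bij_betw_byWitness[where f' = g]) auto
qed

text \<open>The contraction map preserves and reflects membership vertex by vertex:
  \<open>(v, j)\<close> goes to \<open>(u, inv p j)\<close>, which lies in \<open>T\<close> iff
  \<open>inv p j = i\<close>, that is \<open>j = p i\<close>, the index of \<open>T\<close> over
  \<open>v\<close>. With \<open>A\<close> the end set of an edge, contraction keeps the induced
  edges.\<close>

lemma contract_edge_subset_iff:
  assumes T: "T \<in> transversals Y V r" and Y: "verts Y = V \<times> {1..r}" and fin: "finite V"
    and uv: "u \<in> V" "v \<in> V" "u \<noteq> v" and p: "p permutes {1..r}"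
    and i: "(u, i) \<in> T" "(v, p i) \<in> T" and A: "A \<subseteq> verts Y"
  shows "(\<lambda>(w, j). if w = v then (u, inv p j) else (w, j)) ` A \<subseteq> T - fibre r v \<longleftrightarrow> A \<subseteq> T"
proof -
  have ex1: "\<forall>w\<in>V. \<exists>!i. (w, i) \<in> T"
    using T transversals_iff[OF Y fin] by auto
  have u': "(u, k) \<in> T \<longleftrightarrow> k = i" for k using ex1 uv i by blast
  have v': "(v, k) \<in> T \<longleftrightarrow> k = p i" for k using ex1 uv i by blast
  have "inv p j = i \<longleftrightarrow> j = p i" for j
    using permutes_inv_eq[OF p] by metis
  then have "(case x of (w, j) \<Rightarrow> if w = v then (u, inv p j) else (w, j)) \<in> T - fibre r v
      \<longleftrightarrow> x \<in> T" for x
    using u' v' uv by (cases x) (auto simp: fibre_def)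
  then show ?thesis by (simp add: image_subset_iff subset_eq)
qed

text \<open>The orientation \<open>ori\<close> may label the lifts from the other end of \<open>e\<close>, so that the lift joining
  \<open>(u, i)\<close> to \<open>(v, p i)\<close> is called \<open>e\<^sub>i\<close> or \<open>e\<^sub>j\<close> with \<open>j = p i\<close>.\<close>

lemma lift_ends:
  assumes "arc_function X r \<alpha>" and "orientation X ori" and "e \<in> edges X" and "\<not> is_loop X e"
    and arc: "(e, u, v) \<in> arcs X"
  obtains q where "q permutes {1..r}"
    and "\<And>i. ends (cover X r \<alpha> ori) (e, q i) = {(u, i), (v, \<alpha> (e, u, v) i)}"
proof -
  have uv: "ends X e = {u, v}" using arc by (simp add: arcs_def)
  have p: "\<alpha> (e, u, v) permutes {1..r}" using assms by (simp add: arc_function_def)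
  have inv: "\<alpha> (e, v, u) \<circ> \<alpha> (e, u, v) = id" using assms by (simp add: arc_function_def)
  have "ends X e = {fst (ori e), snd (ori e)}"
    using assms(2,3) by (auto simp: orientation_def arcs_def split_beta)
  then have "ori e = (u, v) \<or> ori e = (v, u)"
    using uv by (cases "ori e") (auto simp: doubleton_eq_iff)
  then show thesis
  proof
    assume "ori e = (u, v)"
    then show thesis by (intro that[of id]) (auto simp: cover_def permutes_id)
  next
    assume "ori e = (v, u)"
    then show thesis
      using p inv by (intro that[of "\<alpha> (e, u, v)"]) (auto simp: cover_def fun_eq_iff)
  qed
qed

text \<open>As \<open>q\<close> permutes the labels, every lift is some \<open>(e, q i)\<close>, and
  it can lie in \<open>T\<close> only for the single index \<open>i\<close> of \<open>T\<close> over
  \<open>u\<close>. So the count is 0 or 1.\<close>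

lemma lifts_in_transversal:
  assumes T: "T \<in> transversals Y V r" and Y: "verts Y = V \<times> {1..r}" and fin: "finite V"
    and uv: "u \<in> V" and q: "q permutes {1..r}"
    and ends: "\<And>i. ends Y (e, q i) = {(u, i), (v, p i)}"
  shows "card {f \<in> lifts r e. ends Y f \<subseteq> T} = (if \<exists>i. (u, i) \<in> T \<and> (v, p i) \<in> T then 1 else 0)"
proof -
  have sub: "T \<subseteq> V \<times> {1..r}" and ex1: "\<exists>!i. (u, i) \<in> T"
    using T uv transversals_iff[OF Y fin] by auto
  have "lifts r e = (\<lambda>i. (e, q i)) ` {1..r}"
    using permutes_image[OF q] by (auto simp: lifts_def)
  \<comment> \<open>The right-hand side omits the range of \<open>i\<close>, since
    \<open>(u, i) \<in> T\<close> already puts \<open>i\<close> in \<open>{1..r}\<close>.\<close>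
  then have eq: "{f \<in> lifts r e. ends Y f \<subseteq> T} = (\<lambda>i. (e, q i)) ` {i. (u, i) \<in> T \<and> (v, p i) \<in> T}"
    using sub ends by auto
  show ?thesis
  proof (cases "\<exists>i. (u, i) \<in> T \<and> (v, p i) \<in> T")
    case True
    then obtain i where "{i. (u, i) \<in> T \<and> (v, p i) \<in> T} = {i}" using ex1 by auto
    then show ?thesis using eq True by simp
  next
    case False
    then have "{i. (u, i) \<in> T \<and> (v, p i) \<in> T} = {}" by blast
    then show ?thesis using False by (simp only: eq image_empty card.empty if_False)
  qed
qed

lemma cover_ends_subset:
  assumes X: "looped_multigraph X" and "arc_function X r \<alpha>" and "orientation X ori"
    and f: "f \<in> edges (cover X r \<alpha> ori)"
  shows "ends (cover X r \<alpha> ori) f \<subseteq> verts (cover X r \<alpha> ori)"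
proof -
  obtain e i a b where f_eq: "f = (e, i)" and ori: "ori e = (a, b)"
    by (cases f, cases "ori (fst f)") auto
  then have e: "e \<in> edges X" "i \<in> {1..r}" using f by (auto simp: cover_def)
  then have arc: "(e, a, b) \<in> arcs X" using assms ori by (metis orientation_def)
  then have "\<alpha> (e, a, b) permutes {1..r}" using assms by (simp add: arc_function_def)
  then have "\<alpha> (e, a, b) i \<in> {1..r}" using e(2) by (simp only: permutes_in_image)
  moreover have "{a, b} \<subseteq> verts X"
    using X arc e by (auto simp: looped_multigraph_def arcs_def)
  ultimately show ?thesis using f_eq ori e by (auto simp: cover_def)
qed

theorem theorem1p1:
  fixes X :: "('v, 'e) lmgraph"
    and r :: nat
    and \<alpha> :: "('v, 'e) arc \<Rightarrow> nat \<Rightarrow> nat"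
    and ori :: "'e \<Rightarrow> 'v \<times> 'v"
    and e :: 'e and u v :: 'v
  assumes "looped_multigraph X"
    and "r \<ge> 1"
    and "arc_function X r \<alpha>"
    and "orientation X ori"
    and "e \<in> edges X"
    and "\<not> is_loop X e"
    and "(e, u, v) \<in> arcs X"
  shows "transversal_poly (cover X r \<alpha> ori) (verts X) r =
           [:-1, 1:] * transversal_poly (contract_lifts (cover X r \<alpha> ori) r \<alpha> (e, u, v)) (verts X - {v}) r
           + transversal_poly (delete_lifts (cover X r \<alpha> ori) r e) (verts X) r"
proof -
  define Y where "Y = cover X r \<alpha> ori"
  define Z where "Z = contract_lifts Y r \<alpha> (e, u, v)"
  define D where "D = delete_lifts Y r e"
  define p where "p = \<alpha> (e, u, v)"
  let ?V = "verts X"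
  let ?S = "transversals Y ?V r"
  define M where "M = {T \<in> ?S. \<exists>i. (u, i) \<in> T \<and> (v, p i) \<in> T}"
  \<comment> \<open>The common exponent: that of \<open>T\<close> in \<open>D\<close>, and for
    \<open>T \<in> M\<close> that of \<open>T - fibre r v\<close> in \<open>Z\<close>. In
    \<open>Y\<close> the exponent is larger by one exactly on \<open>M\<close>.\<close>
  define n where "n T = card {f \<in> edges Y - lifts r e. ends Y f \<subseteq> T}" for T
  have fin: "finite ?V" "finite (edges X)" using assms(1) by (auto simp: looped_multigraph_def)
  have ends_e: "ends X e = {u, v}" using assms(7) by (simp add: arcs_def)
  have uv: "u \<in> ?V" "v \<in> ?V" "u \<noteq> v"
    using assms(1,5,6) ends_e by (auto simp: looped_multigraph_def is_loop_def)
  have p: "p permutes {1..r}" using assms(3,7) by (simp add: arc_function_def p_def)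
  have vY: "verts Y = ?V \<times> {1..r}" by (simp add: Y_def cover_def)
  have vZ: "verts Z = (?V - {v}) \<times> {1..r}"
    by (auto simp: Z_def contract_lifts_def vY fibre_def)
  have finY: "finite (edges Y)" using fin by (simp add: Y_def cover_def)
  have lifts_Y: "lifts r e \<subseteq> edges Y" using assms(5) by (auto simp: Y_def cover_def lifts_def)
  have finS: "finite ?S"
    by (rule finite_subset[of _ "Pow (verts Y)"]) (auto simp: transversals_def vY fin)
  \<comment> \<open>\<open>q\<close> turns indices over \<open>u\<close> into the labels fixed by
    \<open>ori\<close>, so that the rest is independent of the orientation of
    \<open>e\<close>.\<close>
  obtain q where q: "q permutes {1..r}" "\<And>i. ends Y (e, q i) = {(u, i), (v, p i)}"
    using lift_ends[OF assms(3-7)] unfolding Y_def p_def by blast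
  have cardY: "card (edges (induced_subgraph Y T)) = n T + (if T \<in> M then 1 else 0)"
    if T: "T \<in> ?S" for T
  proof -
    have "edges (induced_subgraph Y T) =
        {f \<in> edges Y - lifts r e. ends Y f \<subseteq> T} \<union> {f \<in> lifts r e. ends Y f \<subseteq> T}"
      using lifts_Y by (auto simp: induced_subgraph_def)
    moreover have "card \<dots> = n T + card {f \<in> lifts r e. ends Y f \<subseteq> T}"
      unfolding n_def using finY lifts_Y by (intro card_Un_disjoint) (auto intro: finite_subset)
    ultimately show ?thesis
      using lifts_in_transversal[OF T vY fin(1) uv(1) q] T by (simp add: M_def)
  qed
  \<comment> \<open>Deletion keeps the vertices, hence the transversals, so this sum also runs over
    \<open>?S\<close>.\<close>
  have polyD: "transversal_poly D ?V r = (\<Sum>T\<in>?S. monom 1 (n T))"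
    by (simp add: transversal_poly_def D_def delete_lifts_def transversals_def
        induced_subgraph_def n_def)
  have cardZ: "card (edges (induced_subgraph Z (T - fibre r v))) = n T" if T: "T \<in> M" for T
  proof -
    obtain i where i: "T \<in> ?S" "(u, i) \<in> T" "(v, p i) \<in> T" using T by (auto simp: M_def)
    have "ends Z f \<subseteq> T - fibre r v \<longleftrightarrow> ends Y f \<subseteq> T" if "f \<in> edges Y" for f
      using contract_edge_subset_iff[OF i(1) vY fin(1) uv p i(2,3)]
        cover_ends_subset[OF assms(1,3,4)] that
      unfolding Z_def contract_lifts_def p_def by (simp flip: Y_def)
    moreover have "edges Z = edges Y - lifts r e" by (simp add: Z_def contract_lifts_def)
    ultimately have "edges (induced_subgraph Z (T - fibre r v)) =
        {f \<in> edges Y - lifts r e. ends Y f \<subseteq> T}"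
      by (auto simp: induced_subgraph_def)
    then show ?thesis by (simp add: n_def)
  qed
  \<comment> \<open>Reindexing by removal of the fibre of \<open>v\<close> moves the sum from the
    transversals of \<open>Z\<close> to \<open>M\<close>.\<close>
  have polyZ: "transversal_poly Z (?V - {v}) r = (\<Sum>T\<in>M. monom 1 (n T))"
    unfolding transversal_poly_def
    using sum.reindex_bij_betw[OF transversal_extend_bij[OF fin(1) uv vY vZ p],
        of "\<lambda>T. monom (1::int) (card (edges (induced_subgraph Z T)))"] cardZ
    by (simp flip: M_def)
  \<comment> \<open>On \<open>M\<close> the exponent is \<open>n T + 1\<close>, and t^(n+1) = t^n +
    (t - 1) t^n splits off the share of the contraction, with \<open>[:-1, 1:]\<close> as t -
    1.\<close>
  have "transversal_poly Y ?V r =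
      (\<Sum>T\<in>?S. monom 1 (n T) + (if T \<in> M then [:-1, 1:] * monom 1 (n T) else 0))"
    unfolding transversal_poly_def
    by (intro sum.cong) (auto simp: cardY monom_Suc)
  also have "\<dots> = (\<Sum>T\<in>?S. monom 1 (n T)) + (\<Sum>T\<in>?S \<inter> M. [:-1, 1:] * monom 1 (n T))"
    by (simp only: sum.distrib sum.inter_restrict[OF finS])
  also have "?S \<inter> M = M" by (auto simp: M_def)
  finally show ?thesis
    by (simp add: polyD polyZ sum_distrib_left add.commute flip: Y_def D_def Z_def)
qed

end
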